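(* Let $(X,d_{\mathbf{o}},a)$ be an O-metric space satisfying the standing assumptions in the context. Let $\varphi:[0,\infty)\times[a,\infty)\to[a,\infty)$ and $0\le k<\kappa$, where $\kappa:=\sup\mathcal{C}_\varphi$, be such that $\varphi$ satisfies $(\varphi_0)$–$(\varphi_4)$, and $(\varphi_5)$ for this $k$. Let $T:X\to X$ be a map such that for all $x,y\in X$, $$d_{\mathbf{o}}(Tx,Ty)\le\varphi\Big(k,\max\big\{d_{\mathbf{o}}(x,y),\,d_{\mathbf{o}}(x,Tx),\,d_{\mathbf{o}}(y,Ty),\,d_{\mathbf{o}}(x,Ty),\,d_{\mathbf{o}}(y,Tx)\big\}\Big).$$ Suppose $X$ is $T$-orbitally complete. Then $T$ has a unique fixed point if any one of the following conditions holds: (i) $d_{\mathbf{o}}$ is sequentially continuous in the first variable; (ii) $T$ is sequentially continuous; (iii) $\varphi$ also satisfies $(\varphi_6)$ for this $k$.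
   Context: O-metric space and standing assumptions: $a\ge0$ is real and $\mathbf{o}:[a,\infty)\times[a,\infty)\to[a,\infty)$, written $u\,\mathbf{o}\,v$, is a (not necessarily associative) binary operation such that - $(U_1)$ $\mathbf{o}$ is continuous at every point $(u,v)$ with $u=a$ or $v=a$; - $(U_2)$ $\mathbf{o}$ is nondecreasing in both variables, and either [$u\,\mathbf{o}\,a=a\Leftrightarrow u=a$ for all $u\ge a$] or [$a\,\mathbf{o}\,u=a\Leftrightarrow u=a$ for all $u\ge a$]. (In particular $a\,\mathbf{o}\,a=a$.) $X$ is a nonempty set and $d_{\mathbf{o}}:X\times X\to[a,\infty)$ satisfies: $d_{\mathbf{o}}(x,y)=a$ iff $x=y$; $d_{\mathbf{o}}(x,y)=d_{\mathbf{o}}(y,x)$; $d_{\mathbf{o}}(x,z)\le d_{\mathbf{o}}(x,y)\,\mathbf{o}\,d_{\mathbf{o}}(y,z)$. Convergence: $x_n\to x$ means $d_{\mathbf{o}}(x_n,x)\to a$ in $\mathbb{R}$; $(x_n)$ is Cauchy if $d_{\mathbf{o}}(x_n,x_m)\to a$ as $n,m\to\infty$. $X$ is $T$-orbitally complete if every Cauchy sequence contained in the orbit $\{x,Tx,T^2x,\dots\}$ of some point $x\in X$ converges in $X$. $T$ is sequentially continuous if $x_n\to x$ implies $Tx_n\to Tx$; $d_{\mathbf{o}}$ is sequentially continuous in the first variable if $x_n\to x$ implies $d_{\mathbf{o}}(x_n,y)\to d_{\mathbf{o}}(x,y)$ for all $y\in X$. Patterned compositions: a pattern of integers is a sequence $(\alpha_n)$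 with $1\le\alpha_n\le n-1$ for $n\ge2$. It determines functions $h_n$ of $n$ variables in $[a,\infty)$ by $h_1(t)=t$ and $h_n(t_1,\dots,t_n)=h_{\alpha_n}(t_1,\dots,t_{\alpha_n})\,\mathbf{o}\,h_{n-\alpha_n}(t_{\alpha_n+1},\dots,t_n)$ for $n\ge2$; following this pattern, $\mathbf{O}_{i=p}^{q}t_i:=h_{q-p+1}(t_p,\dots,t_q)$ for $p\le q$. The pattern $\{1\}$ is $\alpha_n=1$ for all $n\ge2$ (right-nested composition). $\mathbf{O}_{i=p}^{\infty}t_i:=\lim_{q\to\infty}\mathbf{O}_{i=p}^{q}t_i$ when the limit exists. $\mathcal{C}_\varphi$ is the set of $r\ge0$ for which there is a pattern of integers such that, following this pattern, $\lim_{n,m\to\infty}\mathbf{O}_{i=\min\{n,m\}}^{\max\{n,m\}}\varphi(r^i,\epsilon)=a$ for all $\epsilon\ge a$. (One has $0\in\mathcal{C}_\varphi\subset[0,1)$.) Conditions on $\varphi$: - $(\varphi_0)$ for each $u\ge a$, $r\mapsto\varphi(r,u)$ is continuous at $0$. - $(\varphi_1)$ for each $r\ge0$, $u\mapsto\varphi(r,u)$ is continuous at $a$; and $\varphi$ is increasing in both variables, i.e. $r\mapsto\varphi(r,u)$ is strictly increasing on $[0,\infty)$ for each $u>a$, and $u\mapsto\varphi(r,u)$ is strictly increasing on $[a,\infty)$ for each $r>0$. - $(\varphi_2)$ $\varphi(0,u)=\varphi(r,a)=a$ for all $u\ge a$, $r\ge0$. - $(\varphi_3)$ $\varphi(r_1,\varphi(r_2,u))=\varphi(r_1r_2,u)$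 for all $r_1,r_2\ge0$, $u\ge a$. - $(\varphi_4)$ $\varphi(r,u\,\mathbf{o}\,v)=\varphi(r,u)\,\mathbf{o}\,\varphi(r,v)$ for all $u,v\ge a$, $r\ge0$. - $(\varphi_5)$ (for the given $k$) for every $v\ge a$, the function $w\mapsto v\,\mathbf{o}\,\varphi(k,w)$ on $[a,\infty)$ has a unique fixed point $z$, and its iterates starting from any $w\ge a$ converge to $z$. - $(\varphi_6)$ (for the given $k$) following the pattern $\{1\}$, $\mathbf{O}_{i=1}^{\infty}\varphi(k^i,u)$ exists for every $u\ge a$, and $u\mapsto\mathbf{O}_{i=1}^{\infty}\varphi(k^i,u)$ is continuous at $a$. *)

theory Defs
  imports "HOL-Analysis.Analysis"
begin

locale o_metric_space =
  fixes a :: real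
    and opr :: "real \<Rightarrow> real \<Rightarrow> real"  (infixl "\<odot>" 65)
    and X :: "'x set"
    and d :: "'x \<Rightarrow> 'x \<Rightarrow> real"
  assumes a_nonneg: "0 \<le> a"
    and opr_closed: "\<And>u v. a \<le> u \<Longrightarrow> a \<le> v \<Longrightarrow> a \<le> u \<odot> v"
    and U1: "\<And>u v. a \<le> u \<Longrightarrow> a \<le> v \<Longrightarrow> u = a \<or> v = a \<Longrightarrow>
      continuous (at (u, v) within {a..} \<times> {a..}) (\<lambda>(x, y). x \<odot> y)"
    and U2_mono_left: "\<And>v. a \<le> v \<Longrightarrow> mono_on {a..} (\<lambda>u. u \<odot> v)"
    and U2_mono_right: "\<And>u. a \<le> u \<Longrightarrow> mono_on {a..} (\<lambda>v. u \<odot> v)"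
    and U2_zero: "(\<forall>u\<ge>a. u \<odot> a = a \<longleftrightarrow> u = a) \<or> (\<forall>u\<ge>a. a \<odot> u = a \<longleftrightarrow> u = a)"
    and X_nonempty: "X \<noteq> {}"
    and d_ge: "\<And>x y. x \<in> X \<Longrightarrow> y \<in> X \<Longrightarrow> a \<le> d x y"
    and d_eq_iff: "\<And>x y. x \<in> X \<Longrightarrow> y \<in> X \<Longrightarrow> d x y = a \<longleftrightarrow> x = y"
    and d_sym: "\<And>x y. x \<in> X \<Longrightarrow> y \<in> X \<Longrightarrow> d x y = d y x"
    and d_triangle: "\<And>x y z. x \<in> X \<Longrightarrow> y \<in> X \<Longrightarrow> z \<in> X \<Longrightarrow> d x z \<le> d x y \<odot> d y z"

definition o_converges :: "real \<Rightarrow> ('x \<Rightarrow> 'x \<Rightarrow> real) \<Rightarrow> (nat \<Rightarrow> 'x) \<Rightarrow> 'x \<Rightarrow> bool" where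
  "o_converges a d s x \<longleftrightarrow> (\<lambda>n. d (s n) x) \<longlonglongrightarrow> a"

definition o_Cauchy :: "real \<Rightarrow> ('x \<Rightarrow> 'x \<Rightarrow> real) \<Rightarrow> (nat \<Rightarrow> 'x) \<Rightarrow> bool" where
  "o_Cauchy a d s \<longleftrightarrow>
     ((\<lambda>(n, m). d (s n) (s m)) \<longlongrightarrow> a) (sequentially \<times>\<^sub>F sequentially)"

definition orbit_of :: "('x \<Rightarrow> 'x) \<Rightarrow> 'x \<Rightarrow> 'x set" where
  "orbit_of T x = range (\<lambda>n. (T ^^ n) x)"

definition orbitally_complete ::
    "real \<Rightarrow> 'x set \<Rightarrow> ('x \<Rightarrow> 'x \<Rightarrow> real) \<Rightarrow> ('x \<Rightarrow> 'x) \<Rightarrow> bool" where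
  "orbitally_complete a X d T \<longleftrightarrow>
     (\<forall>x\<in>X. \<forall>s. range s \<subseteq> orbit_of T x \<longrightarrow> o_Cauchy a d s \<longrightarrow>
        (\<exists>l\<in>X. o_converges a d s l))"

definition seq_continuous_map ::
    "real \<Rightarrow> 'x set \<Rightarrow> ('x \<Rightarrow> 'x \<Rightarrow> real) \<Rightarrow> ('x \<Rightarrow> 'x) \<Rightarrow> bool" where
  "seq_continuous_map a X d T \<longleftrightarrow>
     (\<forall>s x. range s \<subseteq> X \<longrightarrow> x \<in> X \<longrightarrow> o_converges a d s x \<longrightarrow>
        o_converges a d (\<lambda>n. T (s n)) (T x))"

definition seq_continuous_fst ::
    "real \<Rightarrow> 'x set \<Rightarrow> ('x \<Rightarrow> 'x \<Rightarrow> real) \<Rightarrow> bool" where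
  "seq_continuous_fst a X d \<longleftrightarrow>
     (\<forall>s x. range s \<subseteq> X \<longrightarrow> x \<in> X \<longrightarrow> o_converges a d s x \<longrightarrow>
        (\<forall>y\<in>X. (\<lambda>n. d (s n) y) \<longlonglongrightarrow> d x y))"

definition pattern :: "(nat \<Rightarrow> nat) \<Rightarrow> bool" where
  "pattern \<alpha> \<longleftrightarrow> (\<forall>n\<ge>2. 1 \<le> \<alpha> n \<and> \<alpha> n \<le> n - 1)"

(* h_n(t_1,...,t_n) with the n arguments given as a list of length n.
   For a pattern alpha, the test succeeds exactly when n \<ge> 2; for other alpha it only
   serves to make the recursion terminate.  The value on the empty list is irrelevant. *)
function pattern_comp ::
    "(real \<Rightarrow> real \<Rightarrow> real) \<Rightarrow> (nat \<Rightarrow> nat) \<Rightarrow> real list \<Rightarrow> real" where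
  "pattern_comp opr \<alpha> ts =
     (let n = length ts in
      if 1 \<le> \<alpha> n \<and> \<alpha> n < n
      then opr (pattern_comp opr \<alpha> (take (\<alpha> n) ts)) (pattern_comp opr \<alpha> (drop (\<alpha> n) ts))
      else hd ts)"
  by auto
termination
  by (relation "Wellfounded.measure (\<lambda>(opr, \<alpha>, ts). length ts)") auto

declare pattern_comp.simps [simp del]

(* The composition of t_p, ..., t_q; meaningful for p \<le> q. *)
definition O_comp ::
    "(real \<Rightarrow> real \<Rightarrow> real) \<Rightarrow> (nat \<Rightarrow> nat) \<Rightarrow> nat \<Rightarrow> nat \<Rightarrow> (nat \<Rightarrow> real) \<Rightarrow> real" where
  "O_comp opr \<alpha> p q t = pattern_comp opr \<alpha> (map t [p..<Suc q])"

(* Under phi0 - phi4 below, 0 belongs to this set and it is contained in [0,1), so its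
   Sup in the reals is a genuine supremum. *)
definition C_phi ::
    "real \<Rightarrow> (real \<Rightarrow> real \<Rightarrow> real) \<Rightarrow> (real \<Rightarrow> real \<Rightarrow> real) \<Rightarrow> real set" where
  "C_phi a opr \<phi> =
     {r. 0 \<le> r \<and>
         (\<exists>\<alpha>. pattern \<alpha> \<and>
            (\<forall>\<epsilon>\<ge>a. ((\<lambda>(n, m). O_comp opr \<alpha> (min n m) (max n m) (\<lambda>i. \<phi> (r ^ i) \<epsilon>)) \<longlongrightarrow> a)
                     (sequentially \<times>\<^sub>F sequentially)))}"

definition phi0 :: "real \<Rightarrow> (real \<Rightarrow> real \<Rightarrow> real) \<Rightarrow> bool" where
  "phi0 a \<phi> \<longleftrightarrow> (\<forall>u\<ge>a. continuous (at 0 within {0..}) (\<lambda>r. \<phi> r u))"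

definition phi1 :: "real \<Rightarrow> (real \<Rightarrow> real \<Rightarrow> real) \<Rightarrow> bool" where
  "phi1 a \<phi> \<longleftrightarrow>
     (\<forall>r\<ge>0. continuous (at a within {a..}) (\<lambda>u. \<phi> r u)) \<and>
     (\<forall>u>a. strict_mono_on {0..} (\<lambda>r. \<phi> r u)) \<and>
     (\<forall>r>0. strict_mono_on {a..} (\<lambda>u. \<phi> r u))"

definition phi2 :: "real \<Rightarrow> (real \<Rightarrow> real \<Rightarrow> real) \<Rightarrow> bool" where
  "phi2 a \<phi> \<longleftrightarrow> (\<forall>u\<ge>a. \<phi> 0 u = a) \<and> (\<forall>r\<ge>0. \<phi> r a = a)"

definition phi3 :: "real \<Rightarrow> (real \<Rightarrow> real \<Rightarrow> real) \<Rightarrow> bool" where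
  "phi3 a \<phi> \<longleftrightarrow> (\<forall>r\<^sub>1\<ge>0. \<forall>r\<^sub>2\<ge>0. \<forall>u\<ge>a. \<phi> r\<^sub>1 (\<phi> r\<^sub>2 u) = \<phi> (r\<^sub>1 * r\<^sub>2) u)"

definition phi4 ::
    "real \<Rightarrow> (real \<Rightarrow> real \<Rightarrow> real) \<Rightarrow> (real \<Rightarrow> real \<Rightarrow> real) \<Rightarrow> bool" where
  "phi4 a opr \<phi> \<longleftrightarrow>
     (\<forall>r\<ge>0. \<forall>u\<ge>a. \<forall>v\<ge>a. \<phi> r (opr u v) = opr (\<phi> r u) (\<phi> r v))"

definition phi5 ::
    "real \<Rightarrow> (real \<Rightarrow> real \<Rightarrow> real) \<Rightarrow> (real \<Rightarrow> real \<Rightarrow> real) \<Rightarrow> real \<Rightarrow> bool" where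
  "phi5 a opr \<phi> k \<longleftrightarrow>
     (\<forall>v\<ge>a. \<exists>z\<ge>a.
        (\<forall>w\<ge>a. opr v (\<phi> k w) = w \<longleftrightarrow> w = z) \<and>
        (\<forall>w\<ge>a. (\<lambda>n. ((\<lambda>w. opr v (\<phi> k w)) ^^ n) w) \<longlonglongrightarrow> z))"

definition phi6 ::
    "real \<Rightarrow> (real \<Rightarrow> real \<Rightarrow> real) \<Rightarrow> (real \<Rightarrow> real \<Rightarrow> real) \<Rightarrow> real \<Rightarrow> bool" where
  "phi6 a opr \<phi> k \<longleftrightarrow>
     (\<forall>u\<ge>a. convergent (\<lambda>q. O_comp opr (\<lambda>_. 1) 1 q (\<lambda>i. \<phi> (k ^ i) u))) \<and>
     continuous (at a within {a..})
       (\<lambda>u. lim (\<lambda>q. O_comp opr (\<lambda>_. 1) 1 q (\<lambda>i. \<phi> (k ^ i) u)))"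

end

theory Submission
  imports Defs
begin

text \<open>
  The argument follows Ciric's theorem on quasi-contractions. For a Picard sequence
  \<open>x\<^sub>n = T\<^sup>n x\<^sub>0\<close> the diameter \<open>\<delta>\<close> of a finite initial piece is attained at a pair containing
  \<open>x\<^sub>0\<close>, hence \<open>\<delta> \<le> v \<odot> \<phi> k \<delta>\<close> with \<open>v = d x\<^sub>0 x\<^sub>1\<close>, and iterating the right-hand side gives
  \<open>\<delta> \<le> z\<close> for the fixed point \<open>z\<close> of \<open>\<phi>\<^sub>5\<close>. The contraction then bounds the diameter of the
  \<open>n\<close>-th tail by \<open>\<phi> (k ^ n) z\<close>, so the sequence is Cauchy because \<open>k < 1\<close>. If its limit
  \<open>l\<close> had \<open>D = d l (T l) > a\<close>, continuity of \<open>d\<close> would contradict the strict contraction and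
  continuity of \<open>T\<close> the uniqueness of limits; under \<open>\<phi>\<^sub>6\<close> one has
  \<open>D \<le> e \<odot> \<phi> k D\<close> for \<open>e\<close> arbitrarily close to \<open>a\<close>, so that the partial compositions of
  \<open>\<phi> (k ^ i) e\<close> stay away from \<open>a\<close>.
\<close>

section \<open>Pattern compositions and iterates of monotone maps\<close>

lemma pattern_comp_const:
  assumes "opr c c = c" and "ts \<noteq> []" and "set ts \<subseteq> {c}"
  shows "pattern_comp opr \<alpha> ts = c"
  using assms(2,3)
proof (induction "length ts" arbitrary: ts rule: less_induct)
  case less
  show ?case
  proof (cases "1 \<le> \<alpha> (length ts) \<and> \<alpha> (length ts) < length ts")
    case True
    have "pattern_comp opr \<alpha> (take (\<alpha> (length ts)) ts) = c"
      using True less.prems by (intro less.hyps) (auto dest: in_set_takeD)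
    moreover have "pattern_comp opr \<alpha> (drop (\<alpha> (length ts)) ts) = c"
      using True less.prems by (intro less.hyps) (auto dest: in_set_dropD)
    ultimately show ?thesis
      using True assms(1) by (subst pattern_comp.simps) (simp add: Let_def)
  next
    case False
    with less.prems show ?thesis
      by (subst pattern_comp.simps) (auto simp: Let_def hd_in_set subset_iff)
  qed
qed

lemma pattern_comp_singleton:
  "pattern_comp opr \<alpha> [t] = t"
  by (subst pattern_comp.simps) (simp add: Let_def)

lemma pattern_comp_one_Cons:
  assumes "ts \<noteq> []"
  shows "pattern_comp opr (\<lambda>_. 1) (t # ts) = opr t (pattern_comp opr (\<lambda>_. 1) ts)"
  using assms by (subst pattern_comp.simps) (simp add: Let_def pattern_comp_singleton)

lemma le_funpow_of_le:
  fixes f :: "real \<Rightarrow> real"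
  assumes "mono_on {a..} f" and "\<And>w. a \<le> w \<Longrightarrow> a \<le> f w" and "a \<le> w" and "w \<le> f w"
  shows "w \<le> (f ^^ n) w"
proof (induction n)
  case (Suc n)
  have "f w \<le> f ((f ^^ n) w)"
    using assms(1,3) Suc by (auto intro: mono_onD)
  with assms(4) show ?case by simp
qed simp

section \<open>Limits in O-metric spaces\<close>

context o_metric_space
begin

lemma opr_a_a: "a \<odot> a = a"
  using U2_zero by blast

lemma opr_mono:
  assumes "a \<le> u" "u \<le> u'" "a \<le> v" "v \<le> v'"
  shows "u \<odot> v \<le> u' \<odot> v'"
proof -
  have "u \<odot> v \<le> u' \<odot> v"
    using mono_onD[OF U2_mono_left[of v], of u u'] assms by simp
  also have "\<dots> \<le> u' \<odot> v'"
    using mono_onD[OF U2_mono_right[of u'], of v v'] assms by simp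
  finally show ?thesis .
qed

lemma d_self: "x \<in> X \<Longrightarrow> d x x = a"
  using d_eq_iff by blast

text \<open>This is \<open>U1\<close> at the corner \<open>(a, a)\<close>; continuity there is
  relative to the quadrant, so both sequences must stay at or above \<open>a\<close>.\<close>

lemma tendsto_opr_a:
  assumes "f \<longlonglongrightarrow> a" "g \<longlonglongrightarrow> a" "\<And>n. a \<le> f n" "\<And>n. a \<le> g n"
  shows "(\<lambda>n. f n \<odot> g n) \<longlonglongrightarrow> a"
proof -
  have "(\<lambda>n. (\<lambda>(x, y). x \<odot> y) (f n, g n)) \<longlonglongrightarrow> (\<lambda>(x, y). x \<odot> y) (a, a)"
    using assms by (intro continuous_within_tendsto_compose'[OF U1] tendsto_Pair) auto
  then show ?thesis
    by (simp add: opr_a_a)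
qed

text \<open>Passing through \<open>s n\<close> bounds \<open>d x y\<close> by a composition that
  tends to \<open>a\<close>.\<close>

lemma o_converges_unique:
  assumes "\<And>n. s n \<in> X" "x \<in> X" "y \<in> X" "o_converges a d s x" "o_converges a d s y"
  shows "x = y"
proof -
  have "(\<lambda>n. d (s n) x \<odot> d (s n) y) \<longlonglongrightarrow> a"
    using assms by (intro tendsto_opr_a) (auto simp: o_converges_def d_ge)
  moreover have "d x y \<le> d (s n) x \<odot> d (s n) y" for n
    using d_triangle[of x "s n" y] d_sym[of x "s n"] assms(1-3) by simp
  ultimately have "d x y \<le> a"
    by (intro LIMSEQ_le_const) auto
  with assms(2,3) d_ge[of x y] d_eq_iff[of x y] show ?thesis by simp
qed

end

section \<open>The dilations \<open>\<phi> r\<close>\<close>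

locale dilated_o_metric_space = o_metric_space +
  fixes \<phi> :: "real \<Rightarrow> real \<Rightarrow> real"
  assumes \<phi>_ge: "\<And>r u. 0 \<le> r \<Longrightarrow> a \<le> u \<Longrightarrow> a \<le> \<phi> r u"
    and \<phi>0: "phi0 a \<phi>" and \<phi>1: "phi1 a \<phi>" and \<phi>2: "phi2 a \<phi>"
    and \<phi>3: "phi3 a \<phi>" and \<phi>4: "phi4 a opr \<phi>"
begin

lemma \<phi>_strict_right: "0 < r \<Longrightarrow> a \<le> u \<Longrightarrow> u < v \<Longrightarrow> \<phi> r u < \<phi> r v"
  using \<phi>1 unfolding phi1_def strict_mono_on_def by auto

lemma \<phi>_strict_left: "a < u \<Longrightarrow> 0 \<le> r \<Longrightarrow> r < s \<Longrightarrow> \<phi> r u < \<phi> s u"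
  using \<phi>1 unfolding phi1_def strict_mono_on_def by auto

lemma \<phi>_zero: "a \<le> u \<Longrightarrow> \<phi> 0 u = a"
  using \<phi>2 by (simp add: phi2_def)

lemma \<phi>_a: "0 \<le> r \<Longrightarrow> \<phi> r a = a"
  using \<phi>2 by (simp add: phi2_def)

lemma \<phi>_\<phi>: "0 \<le> r \<Longrightarrow> 0 \<le> s \<Longrightarrow> a \<le> u \<Longrightarrow> \<phi> r (\<phi> s u) = \<phi> (r * s) u"
  using \<phi>3 by (simp add: phi3_def)

lemma \<phi>_opr: "0 \<le> r \<Longrightarrow> a \<le> u \<Longrightarrow> a \<le> v \<Longrightarrow> \<phi> r (u \<odot> v) = \<phi> r u \<odot> \<phi> r v"
  using \<phi>4 by (simp add: phi4_def)

lemma \<phi>_mono_right: "0 \<le> r \<Longrightarrow> a \<le> u \<Longrightarrow> u \<le> v \<Longrightarrow> \<phi> r u \<le> \<phi> r v"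
  using \<phi>_strict_right[of r u v] \<phi>_zero[of u] \<phi>_zero[of v] by (cases "r = 0"; cases "u = v") auto

lemma \<phi>_mono_left: "a \<le> u \<Longrightarrow> 0 \<le> r \<Longrightarrow> r \<le> s \<Longrightarrow> \<phi> r u \<le> \<phi> s u"
  using \<phi>_strict_left[of u r s] \<phi>_a[of r] \<phi>_a[of s] by (cases "u = a"; cases "r = s") auto

text \<open>By \<open>\<phi>3\<close> the map \<open>\<phi> 1\<close> is idempotent, and being
  strictly increasing it is injective.\<close>

lemma \<phi>_one:
  assumes "a \<le> u"
  shows "\<phi> 1 u = u"
proof -
  have "\<phi> 1 (\<phi> 1 u) = \<phi> 1 u" "a \<le> \<phi> 1 u"
    using assms \<phi>_\<phi>[of 1 1 u] \<phi>_ge[of 1 u] by auto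
  then show ?thesis
    using assms \<phi>_strict_right[of 1 u "\<phi> 1 u"] \<phi>_strict_right[of 1 "\<phi> 1 u" u]
    by (cases u "\<phi> 1 u" rule: linorder_cases) auto
qed

lemma \<phi>_less: "0 \<le> k \<Longrightarrow> k < 1 \<Longrightarrow> a < u \<Longrightarrow> \<phi> k u < u"
  using \<phi>_strict_left[of u k 1] \<phi>_one[of u] by simp

lemma \<phi>_power_tendsto:
  assumes "0 \<le> k" "k < 1" "a \<le> u"
  shows "(\<lambda>n. \<phi> (k ^ n) u) \<longlonglongrightarrow> a"
proof -
  have "(\<lambda>n. \<phi> (k ^ n) u) \<longlonglongrightarrow> \<phi> 0 u"
    using \<phi>0 assms
    by (intro continuous_within_tendsto_compose'[of 0 "{0..}" "\<lambda>r. \<phi> r u"] LIMSEQ_power_zero)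
      (auto simp: phi0_def)
  with \<phi>_zero[OF assms(3)] show ?thesis by simp
qed

text \<open>Replaces continuity of \<open>\<phi> k\<close> at \<open>u\<close>, which is only assumed at \<open>a\<close>.\<close>

lemma \<phi>_less_nhd:
  assumes "0 \<le> k" "k < 1" "a < u"
  obtains u' c where "u < u'" "c < u" "\<And>w. a \<le> w \<Longrightarrow> w \<le> u' \<Longrightarrow> \<phi> k w \<le> c"
proof
  \<comment> \<open>Since \<open>s * s \<ge> k\<close>, one factor \<open>s\<close> cancels the
    enlargement \<open>u' = \<phi> (1 / s) u\<close> and the other still leaves the value
    \<open>c = \<phi> s u\<close> below \<open>u\<close>. The \<open>1/2\<close> keeps
    \<open>s\<close> positive when \<open>k = 0\<close>.\<close>
  define s where "s = sqrt (max k (1/2))"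
  have s: "0 < s" "s < 1" "s * s = max k (1/2)"
    using assms by (auto simp: s_def)
  have "1 < 1 / s" using s by simp
  then show "u < \<phi> (1 / s) u"
    using \<phi>_strict_left[of u 1 "1 / s"] \<phi>_one[of u] assms(3) by simp
  show "\<phi> s u < u"
    using s assms(3) by (intro \<phi>_less) auto
  fix w assume w: "a \<le> w" "w \<le> \<phi> (1 / s) u"
  have "\<phi> k w \<le> \<phi> (s * s) w"
    using assms s w by (intro \<phi>_mono_left) auto
  also have "\<dots> \<le> \<phi> (s * s) (\<phi> (1 / s) u)"
    using w s by (intro \<phi>_mono_right) auto
  also have "\<dots> = \<phi> s u"
    using s(1) assms by (subst \<phi>_\<phi>) (auto simp: field_simps)
  finally show "\<phi> k w \<le> \<phi> s u" .
qed

section \<open>Members of \<open>C_phi\<close> and the bound \<open>k < 1\<close>\<close>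

lemma zero_in_C_phi: "0 \<in> C_phi a opr \<phi>"
proof -
  have "((\<lambda>(n, m). O_comp opr (\<lambda>_. 1) (min n m) (max n m) (\<lambda>i. \<phi> (0 ^ i) \<epsilon>)) \<longlongrightarrow> a)
     (sequentially \<times>\<^sub>F sequentially)" if "a \<le> \<epsilon>" for \<epsilon>
  proof (rule tendsto_eventually)
    \<comment> \<open>Indices start at 1 because \<open>0 ^ 0 = 1\<close>; from there on every term
      is \<open>a\<close>, and \<open>a \<odot> a = a\<close>.\<close>
    have "O_comp opr (\<lambda>_. 1) (min n m) (max n m) (\<lambda>i. \<phi> (0 ^ i) \<epsilon>) = a" if "1 \<le> n" "1 \<le> m" for n m
      unfolding O_comp_def using that \<open>a \<le> \<epsilon>\<close>
      by (intro pattern_comp_const) (auto simp: opr_a_a power_0_left \<phi>_zero)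
    then show "\<forall>\<^sub>F p in sequentially \<times>\<^sub>F sequentially.
        (case p of (n, m) \<Rightarrow> O_comp opr (\<lambda>_. 1) (min n m) (max n m) (\<lambda>i. \<phi> (0 ^ i) \<epsilon>)) = a"
      using eventually_ge_at_top[of "1::nat"]
      by (auto simp: eventually_prod_filter intro!: exI[of _ "\<lambda>n. 1 \<le> n"])
  qed
  then show ?thesis
    by (auto simp: C_phi_def pattern_def intro!: exI[of _ "\<lambda>_. 1"])
qed

text \<open>On the diagonal \<open>n = m\<close> the composition is the single term
  \<open>\<phi> (r ^ n) (a + 1)\<close>, which would stay at least \<open>a + 1\<close> if
  \<open>r \<ge> 1\<close>.\<close>

lemma C_phi_less_one:
  assumes "r \<in> C_phi a opr \<phi>"
  shows "r < 1"
proof (rule ccontr)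
  assume "\<not> r < 1"
  obtain \<alpha> where "((\<lambda>(n, m). O_comp opr \<alpha> (min n m) (max n m) (\<lambda>i. \<phi> (r ^ i) (a + 1))) \<longlongrightarrow> a)
      (sequentially \<times>\<^sub>F sequentially)"
    using assms unfolding C_phi_def mem_Collect_eq by (meson le_add_same_cancel1 zero_le_one)
  moreover have "filterlim (\<lambda>n. (n, n)) (sequentially \<times>\<^sub>F sequentially) sequentially"
    by (intro filterlim_Pair filterlim_ident)
  ultimately have "(\<lambda>n. (\<lambda>(n, m). O_comp opr \<alpha> (min n m) (max n m) (\<lambda>i. \<phi> (r ^ i) (a + 1))) (n, n)) \<longlonglongrightarrow> a"
    by (rule filterlim_compose)
  then have "(\<lambda>n. \<phi> (r ^ n) (a + 1)) \<longlonglongrightarrow> a"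
    by (simp add: O_comp_def pattern_comp_singleton)
  moreover have "a + 1 \<le> \<phi> (r ^ n) (a + 1)" for n
    using \<phi>_mono_left[of "a + 1" 1 "r ^ n"] \<phi>_one[of "a + 1"] \<open>\<not> r < 1\<close> by simp
  ultimately have "a + 1 \<le> a"
    by (intro LIMSEQ_le_const) auto
  then show False by simp
qed

text \<open>Some member of \<open>C_phi\<close> exceeds \<open>k\<close>;
  \<open>zero_in_C_phi\<close> supplies the nonemptiness behind this.\<close>

lemma less_Sup_C_phi_less_one:
  assumes "k < Sup (C_phi a opr \<phi>)"
  shows "k < 1"
  using less_cSupD[OF _ assms] zero_in_C_phi C_phi_less_one by fastforce

text \<open>Bridge between \<open>phi6\<close> and \<open>phi5\<close>: by \<open>\<phi>3\<close>
  and \<open>\<phi>4\<close> the power \<open>k ^ p\<close> can be pulled out of a right-nested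
  composition, leaving an iterate of the map in \<open>phi5\<close>. The induction keeps
  \<open>p\<close> arbitrary because the tail begins at \<open>Suc p\<close>.\<close>

lemma pattern_comp_one_\<phi>_power:
  assumes "0 \<le> k" "a \<le> u"
  shows "pattern_comp opr (\<lambda>_. 1) (map (\<lambda>i. \<phi> (k ^ i) u) [p..<Suc (p + n)])
    = \<phi> (k ^ p) (((\<lambda>w. u \<odot> \<phi> k w) ^^ n) u)"
proof (induction n arbitrary: p)
  case 0
  show ?case by (simp add: pattern_comp_singleton)
next
  case (Suc n)
  let ?f = "\<lambda>w. u \<odot> \<phi> k w"
  have ge: "a \<le> (?f ^^ n) u" for n
    using assms by (induction n) (auto intro: opr_closed \<phi>_ge)
  have "[p..<Suc (p + Suc n)] = p # [Suc p..<Suc (Suc p + n)]"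
    by (simp add: upt_conv_Cons del: upt_Suc)
  then have "pattern_comp opr (\<lambda>_. 1) (map (\<lambda>i. \<phi> (k ^ i) u) [p..<Suc (p + Suc n)])
      = \<phi> (k ^ p) u \<odot> \<phi> (k ^ Suc p) ((?f ^^ n) u)"
    by (simp only: list.map Suc.IH[of "Suc p", symmetric]) (subst pattern_comp_one_Cons, simp_all)
  also have "\<dots> = \<phi> (k ^ p) (?f ((?f ^^ n) u))"
    using assms ge[of n] by (simp add: \<phi>_opr \<phi>_\<phi> \<phi>_ge mult.commute)
  finally show ?case by simp
qed

end

section \<open>Quasi-contractions and their orbits\<close>

locale quasi_contraction = dilated_o_metric_space +
  fixes k :: real and T :: "'x \<Rightarrow> 'x"
  assumes k_nonneg: "0 \<le> k" and k_less: "k < 1"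
    and \<phi>5: "phi5 a opr \<phi> k"
    and T_into: "T \<in> X \<rightarrow> X"
    and T_contr: "\<And>x y. x \<in> X \<Longrightarrow> y \<in> X \<Longrightarrow>
      d (T x) (T y) \<le> \<phi> k (Max {d x y, d x (T x), d y (T y), d x (T y), d y (T x)})"
begin

lemma T_in: "x \<in> X \<Longrightarrow> T x \<in> X"
  using T_into by auto

lemma T_power_in: "x \<in> X \<Longrightarrow> (T ^^ n) x \<in> X"
  by (induction n) (auto intro: T_in)

lemma T_contr_le:
  assumes "x \<in> X" "y \<in> X"
    and "d x y \<le> M" "d x (T x) \<le> M" "d y (T y) \<le> M" "d x (T y) \<le> M" "d y (T x) \<le> M"
  shows "d (T x) (T y) \<le> \<phi> k M"
proof -
  have "a \<le> Max {d x y, d x (T x), d y (T y), d x (T y), d y (T x)}"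
    using assms d_ge[of x y] by (auto simp: le_max_iff_disj)
  moreover have "Max {d x y, d x (T x), d y (T y), d x (T y), d y (T x)} \<le> M"
    using assms by auto
  ultimately show ?thesis
    using T_contr[OF assms(1,2)] \<phi>_mono_right[OF k_nonneg] by (meson order_trans)
qed

text \<open>Between two fixed points each of the five distances is \<open>d x y\<close> or
  \<open>a\<close>, so \<open>d x y \<le> \<phi> k (d x y)\<close>, which is impossible above
  \<open>a\<close>.\<close>

lemma fixed_point_unique:
  assumes "x \<in> X" "y \<in> X" "T x = x" "T y = y"
  shows "x = y"
proof (rule ccontr)
  assume "x \<noteq> y"
  then have "a < d x y"
    using assms d_ge[of x y] d_eq_iff[of x y] by auto
  moreover have "d (T x) (T y) \<le> \<phi> k (d x y)"
    using assms d_sym[of x y] d_self d_ge[of x y] by (intro T_contr_le) auto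
  ultimately show False
    using \<phi>_less[OF k_nonneg k_less, of "d x y"] assms by simp
qed

text \<open>A point that a monotone map does not lower stays below all its iterates, hence below
  their limit.\<close>

lemma le_phi5_limit:
  assumes "a \<le> v" "a \<le> w" "w \<le> v \<odot> \<phi> k w" and "(\<lambda>n. ((\<lambda>w. v \<odot> \<phi> k w) ^^ n) w) \<longlonglongrightarrow> z"
  shows "w \<le> z"
proof -
  have "w \<le> ((\<lambda>w. v \<odot> \<phi> k w) ^^ n) w" for n
    using assms(1-3) k_nonneg
    by (intro le_funpow_of_le[where a = a] mono_onI opr_mono \<phi>_mono_right opr_closed \<phi>_ge) auto
  with assms(4) show ?thesis
    by (intro LIMSEQ_le_const) auto
qed

lemma orbit_bounded:
  assumes "x \<in> X"
  obtains z where "a \<le> z" "\<And>i j. d ((T ^^ i) x) ((T ^^ j) x) \<le> z"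
proof -
  let ?x = "\<lambda>n. (T ^^ n) x"
  let ?f = "\<lambda>w. d x (T x) \<odot> \<phi> k w"
  have v: "a \<le> d x (T x)" using assms by (intro d_ge T_in)
  \<comment> \<open>This \<open>z\<close> depends on \<open>x\<close> alone, so it will bound all
    pairs \<open>i\<close>, \<open>j\<close> at once.\<close>
  obtain z where z: "a \<le> z" "\<And>w. a \<le> w \<Longrightarrow> (\<lambda>n. (?f ^^ n) w) \<longlonglongrightarrow> z"
    using \<phi>5 v by (auto simp: phi5_def)
  have "d (?x i) (?x j) \<le> z" for i j
  proof -
    define S where "S = (\<lambda>(i, j). d (?x i) (?x j)) ` ({..max i j} \<times> {..max i j})"
    have fin: "finite S" by (simp add: S_def)
    define \<delta> where "\<delta> = Max S"
    have le: "d (?x p) (?x q) \<le> \<delta>" if "p \<le> max i j" "q \<le> max i j" for p q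
      unfolding \<delta>_def using fin by (rule Max_ge) (use that in \<open>force simp: S_def\<close>)
    have "\<delta> \<in> S"
      unfolding \<delta>_def using fin by (rule Max_in) (auto simp: S_def)
    then obtain p q where pq: "p \<le> max i j" "q \<le> max i j" "\<delta> = d (?x p) (?x q)"
      by (auto simp: S_def)
    \<comment> \<open>The five distances involve only indices up to \<open>max i j\<close>, so
      \<open>\<delta>\<close> bounds them all.\<close>
    have contr: "d (?x (Suc p)) (?x (Suc q)) \<le> \<phi> k \<delta>"
      if "Suc p \<le> max i j" "Suc q \<le> max i j" for p q
      using T_contr_le[OF T_power_in T_power_in, OF assms assms, of p q \<delta>]
        le[of p q] le[of p "Suc p"] le[of q "Suc q"] le[of p "Suc q"] le[of q "Suc p"] that by simp
    have ge: "a \<le> \<delta>" using pq T_power_in[OF assms] by (simp add: d_ge)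
    have start: "\<delta> \<le> ?f \<delta>" if "\<delta> = d x (?x (Suc r))" "Suc r \<le> max i j" for r
    proof -
      have "\<delta> \<le> d x (T x) \<odot> d (?x 1) (?x (Suc r))"
        using d_triangle[of x "T x" "?x (Suc r)"] assms T_power_in[OF assms, of "Suc r"] T_in that by simp
      also have "\<dots> \<le> ?f \<delta>"
        using contr[of 0 r] that v assms T_in T_power_in[OF assms]
        by (intro opr_mono) (auto intro: d_ge)
      finally show ?thesis .
    qed
    have "\<delta> \<le> ?f \<delta>"
    proof (cases "\<delta> = a")
      case True
      then show ?thesis using v k_nonneg by (simp add: opr_closed \<phi>_ge)
    next
      case False
      then have "\<phi> k \<delta> < \<delta>" using ge by (intro \<phi>_less k_nonneg k_less) auto
      \<comment> \<open>If both indices were 0, \<open>\<delta>\<close> would be \<open>a\<close>;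
        if both were positive, \<open>contr\<close> would give
        \<open>\<delta> \<le> \<phi> k \<delta>\<close>. So the maximum pairs index 0 with a
        positive one.\<close>
      moreover have "p \<noteq> 0 \<or> q \<noteq> 0"
        using False pq(3) d_self[OF assms] by (cases p; cases q) auto
      ultimately consider r where "p = 0" "q = Suc r" | r where "q = 0" "p = Suc r"
        using contr pq by (cases p; cases q) force+
      then show ?thesis
      proof cases
        case 1
        with pq show ?thesis by (intro start) auto
      next
        case 2
        then have "\<delta> = d x (?x (Suc r))"
          using pq d_sym[of "?x (Suc r)" x] T_power_in[OF assms, of "Suc r"] assms by simp
        with 2 pq show ?thesis by (intro start) auto
      qed
    qed
    with v ge have "\<delta> \<le> z" by (intro le_phi5_limit[OF _ _ _ z(2)])
    with le[of i j] show ?thesis by simp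
  qed
  with z(1) that show thesis by blast
qed

text \<open>Stripping one \<open>T\<close> leaves five distances between indices at least
  \<open>n\<close>, all covered by the induction hypothesis; \<open>\<phi>3\<close> merges the new
  factor \<open>k\<close> into the power.\<close>

lemma orbit_tail_bounded:
  assumes "x \<in> X" "a \<le> z" "\<And>i j. d ((T ^^ i) x) ((T ^^ j) x) \<le> z"
  shows "n \<le> i \<Longrightarrow> n \<le> j \<Longrightarrow> d ((T ^^ i) x) ((T ^^ j) x) \<le> \<phi> (k ^ n) z"
proof (induction n arbitrary: i j)
  case 0
  then show ?case using assms by (simp add: \<phi>_one)
next
  case (Suc n)
  then obtain p q where pq: "i = Suc p" "j = Suc q" "n \<le> p" "n \<le> q"
    by (metis Suc_le_D Suc_le_mono)
  have "d (T ((T ^^ p) x)) (T ((T ^^ q) x)) \<le> \<phi> k (\<phi> (k ^ n) z)"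
    using Suc.IH[of p q] Suc.IH[of p "Suc p"] Suc.IH[of q "Suc q"] Suc.IH[of p "Suc q"]
      Suc.IH[of q "Suc p"] pq T_power_in[OF assms(1)]
    by (intro T_contr_le) auto
  with pq assms k_nonneg show ?case by (simp add: \<phi>_\<phi>)
qed

lemma orbit_Cauchy:
  assumes "x \<in> X"
  shows "o_Cauchy a d (\<lambda>n. (T ^^ n) x)"
proof -
  obtain z where z: "a \<le> z" "\<And>i j. d ((T ^^ i) x) ((T ^^ j) x) \<le> z"
    using orbit_bounded[OF assms] by blast
  show ?thesis
    unfolding o_Cauchy_def
  proof (rule order_tendstoI)
    fix y assume "y < a"
    then have "y < d ((T ^^ n) x) ((T ^^ m) x)" for n m
      using d_ge[of "(T ^^ n) x" "(T ^^ m) x"] T_power_in[OF assms] by fastforce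
    then show "\<forall>\<^sub>F p in sequentially \<times>\<^sub>F sequentially.
        y < (case p of (n, m) \<Rightarrow> d ((T ^^ n) x) ((T ^^ m) x))"
      by (auto intro: always_eventually)
  next
    fix y assume "a < y"
    then obtain N where "\<phi> (k ^ N) z < y"
      using order_tendstoD(2)[OF \<phi>_power_tendsto[OF k_nonneg k_less z(1)]]
      by (auto simp: eventually_sequentially)
    then have "d ((T ^^ n) x) ((T ^^ m) x) < y" if "N \<le> n" "N \<le> m" for n m
      using orbit_tail_bounded[OF assms z that] by simp
    then show "\<forall>\<^sub>F p in sequentially \<times>\<^sub>F sequentially.
        (case p of (n, m) \<Rightarrow> d ((T ^^ n) x) ((T ^^ m) x)) < y"
      using eventually_ge_at_top[of N]
      by (auto simp: eventually_prod_filter intro!: exI[of _ "\<lambda>n. N \<le> n"])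
  qed
qed

section \<open>The limit of an orbit is a fixed point\<close>

text \<open>Of the five distances in the contraction, three tend to \<open>a\<close> and are
  absorbed by \<open>e\<close>; the two measured to \<open>T l\<close> remain. Later
  \<open>e\<close> is taken to be \<open>d l (T l)\<close>.\<close>

lemma limit_step:
  assumes "x \<in> X" "l \<in> X" "o_converges a d (\<lambda>n. (T ^^ n) x) l" "a < e"
  shows "\<forall>\<^sub>F n in sequentially. d ((T ^^ Suc n) x) (T l)
    \<le> \<phi> k (max e (max (d l (T l)) (d ((T ^^ n) x) (T l))))"
proof -
  have conv: "(\<lambda>n. d ((T ^^ n) x) l) \<longlonglongrightarrow> a"
    using assms(3) by (simp add: o_converges_def)
  note evs = order_tendstoD(2)[OF conv \<open>a < e\<close>]
  have "((\<lambda>(n, m). d ((T ^^ n) x) ((T ^^ m) x)) \<longlongrightarrow> a) (sequentially \<times>\<^sub>F sequentially)"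
    using orbit_Cauchy[OF assms(1)] by (simp add: o_Cauchy_def)
  \<comment> \<open>Consecutive distances are the Cauchy double limit restricted to the pairs
    \<open>(n, Suc n)\<close>.\<close>
  moreover have "filterlim (\<lambda>n. (n, Suc n)) (sequentially \<times>\<^sub>F sequentially) sequentially"
    by (intro filterlim_Pair filterlim_ident filterlim_Suc)
  ultimately have "(\<lambda>n. (\<lambda>(n, m). d ((T ^^ n) x) ((T ^^ m) x)) (n, Suc n)) \<longlonglongrightarrow> a"
    by (rule filterlim_compose)
  then have "(\<lambda>n. d ((T ^^ n) x) ((T ^^ Suc n) x)) \<longlonglongrightarrow> a" by simp
  from order_tendstoD(2)[OF this \<open>a < e\<close>] evs order_tendstoD(2)[OF LIMSEQ_Suc[OF conv] \<open>a < e\<close>]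
  show ?thesis
  proof eventually_elim
    case (elim n)
    have "d (T ((T ^^ n) x)) (T l) \<le> \<phi> k (max e (max (d l (T l)) (d ((T ^^ n) x) (T l))))"
      using elim d_sym[OF T_power_in[OF assms(1)] assms(2), of "Suc n"]
      by (intro T_contr_le T_power_in assms) auto
    then show ?case by simp
  qed
qed

text \<open>The shifted orbit converges to \<open>l\<close> as a tail and to \<open>T l\<close> by
  continuity.\<close>

lemma limit_fixed_seq_continuous_map:
  assumes "x \<in> X" "l \<in> X" "o_converges a d (\<lambda>n. (T ^^ n) x) l" "seq_continuous_map a X d T"
  shows "T l = l"
proof (rule o_converges_unique)
  show "o_converges a d (\<lambda>n. (T ^^ Suc n) x) l"
    using LIMSEQ_Suc assms(3) by (auto simp: o_converges_def simp del: funpow.simps)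
  have "range (\<lambda>n. (T ^^ n) x) \<subseteq> X"
    using T_power_in[OF assms(1)] by auto
  with assms(2-4) show "o_converges a d (\<lambda>n. (T ^^ Suc n) x) (T l)"
    unfolding seq_continuous_map_def by simp
qed (use assms T_in T_power_in[of x "Suc _"] in auto)

lemma limit_fixed_seq_continuous_fst:
  assumes "x \<in> X" "l \<in> X" "o_converges a d (\<lambda>n. (T ^^ n) x) l" "seq_continuous_fst a X d"
  shows "T l = l"
proof (rule ccontr)
  assume "T l \<noteq> l"
  define D where "D = d l (T l)"
  have "a < D"
    using \<open>T l \<noteq> l\<close> d_ge[of l "T l"] d_eq_iff[of l "T l"] assms(2) T_in by (fastforce simp: D_def)
  have "range (\<lambda>n. (T ^^ n) x) \<subseteq> X"
    using T_power_in[OF assms(1)] by auto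
  then have lim: "(\<lambda>n. d ((T ^^ n) x) (T l)) \<longlonglongrightarrow> D"
    using assms(2-4) T_in unfolding seq_continuous_fst_def D_def by blast
  obtain u' c where uc: "D < u'" "c < D" "\<And>w. a \<le> w \<Longrightarrow> w \<le> u' \<Longrightarrow> \<phi> k w \<le> c"
    using \<phi>_less_nhd[OF k_nonneg k_less \<open>a < D\<close>] by blast
  \<comment> \<open>The contraction, with \<open>e = D\<close>, eventually bounds the next distance
    to \<open>T l\<close> by \<open>c < D\<close>, while these distances tend to
    \<open>D\<close>.\<close>
  have "\<forall>\<^sub>F n in sequentially. False"
    using limit_step[OF assms(1-3) \<open>a < D\<close>] order_tendstoD(2)[OF lim uc(1)]
      order_tendstoD(1)[OF LIMSEQ_Suc[OF lim] uc(2)]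
  proof eventually_elim
    case (elim n)
    have "\<phi> k (max D (max D (d ((T ^^ n) x) (T l)))) \<le> c"
      using elim(2) uc(1) \<open>a < D\<close> by (intro uc(3)) auto
    with elim(1,3) show ?case by (simp add: D_def)
  qed
  then show False by simp
qed

lemma limit_fixed_phi6:
  assumes "x \<in> X" "l \<in> X" "o_converges a d (\<lambda>n. (T ^^ n) x) l" "phi6 a opr \<phi> k"
  shows "T l = l"
proof (rule ccontr)
  assume "T l \<noteq> l"
  define D where "D = d l (T l)"
  let ?y = "\<lambda>n. d ((T ^^ n) x) (T l)"
  let ?e = "\<lambda>n. d ((T ^^ Suc n) x) l"
  have D: "a < D"
    using \<open>T l \<noteq> l\<close> d_ge[of l "T l"] d_eq_iff[of l "T l"] assms(2) T_in by (fastforce simp: D_def)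
  have e_ge: "a \<le> ?e n" for n
    using T_power_in[OF assms(1)] assms(2) by (intro d_ge)
  have y_ge: "a \<le> ?y n" for n
    using T_power_in[OF assms(1)] assms(2) T_in by (intro d_ge) auto
  have e_lim: "?e \<longlonglongrightarrow> a"
    using LIMSEQ_Suc assms(3) by (auto simp: o_converges_def simp del: funpow.simps)
  have step: "\<forall>\<^sub>F n in sequentially. ?y (Suc n) \<le> \<phi> k (max D (?y n))"
    using limit_step[OF assms(1-3) D] by (simp add: D_def)
  \<comment> \<open>Otherwise the maximum in \<open>step\<close> is eventually \<open>?y n\<close>,
    and \<open>?y\<close> is driven to \<open>a\<close> by the powers of \<open>k\<close> while
    staying above \<open>D\<close>.\<close>
  have freq: "\<exists>\<^sub>F n in sequentially. ?y n \<le> D"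
  proof (rule ccontr)
    assume "\<not> ?thesis"
    then have "\<forall>\<^sub>F n in sequentially. D < ?y n"
      by (simp add: not_frequently not_le)
    from eventually_conj[OF this step]
    obtain N where N: "\<And>n. N \<le> n \<Longrightarrow> D < ?y n \<and> ?y (Suc n) \<le> \<phi> k (max D (?y n))"
      unfolding eventually_sequentially by blast
    have "?y (N + n) \<le> \<phi> (k ^ n) (?y N)" for n
    proof (induction n)
      case 0
      show ?case using y_ge[of N] by (simp add: \<phi>_one)
    next
      case (Suc n)
      have "?y (Suc (N + n)) \<le> \<phi> k (?y (N + n))"
        using N[of "N + n"] max.absorb2[of D "?y (N + n)"] by auto
      also have "\<dots> \<le> \<phi> k (\<phi> (k ^ n) (?y N))"
        using Suc y_ge k_nonneg by (intro \<phi>_mono_right) auto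
      finally show ?case using y_ge[of N] k_nonneg by (simp add: \<phi>_\<phi>)
    qed
    then have "D \<le> \<phi> (k ^ n) (?y N)" for n
      using N[of "N + n"] by (meson le_add1 less_imp_le order_trans)
    then have "D \<le> a"
      using \<phi>_power_tendsto[OF k_nonneg k_less y_ge[of N]] by (intro LIMSEQ_le_const) auto
    with D show False by simp
  qed
  \<comment> \<open>Whenever \<open>?y n \<le> D\<close>, \<open>step\<close> gives
    \<open>?y (Suc n) \<le> \<phi> k D\<close>; the triangle inequality then runs through
    \<open>(T ^^ Suc n) x\<close>.\<close>
  have freq': "\<exists>\<^sub>F n in sequentially. D \<le> ?e n \<odot> \<phi> k D"
    using frequently_eventually_frequently[OF freq step]
  proof (rule frequently_elim1)
    fix n assume n: "?y n \<le> D \<and> ?y (Suc n) \<le> \<phi> k (max D (?y n))"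
    have "D \<le> d l ((T ^^ Suc n) x) \<odot> ?y (Suc n)"
      unfolding D_def using T_power_in[OF assms(1)] assms(2) T_in by (intro d_triangle) auto
    also have "d l ((T ^^ Suc n) x) = ?e n"
      using T_power_in[OF assms(1)] assms(2) by (intro d_sym)
    also have "?e n \<odot> ?y (Suc n) \<le> ?e n \<odot> \<phi> k D"
      using n e_ge[of n] y_ge[of "Suc n"] by (intro opr_mono) (auto simp: max_def)
    finally show "D \<le> ?e n \<odot> \<phi> k D" .
  qed
  show False
  \<comment> \<open>For \<open>k = 0\<close> the map \<open>\<phi> k\<close> is constantly
    \<open>a\<close>, so the threshold \<open>\<phi> k w\<close> of the other case would not exceed
    \<open>a\<close>; here \<open>?e n \<odot> a\<close> tends to \<open>a\<close> directly.\<close>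
  proof (cases "k = 0")
    case True
    have "(\<lambda>n. ?e n \<odot> a) \<longlonglongrightarrow> a"
      using e_lim e_ge by (intro tendsto_opr_a) auto
    from order_tendstoD(2)[OF this D] have "\<forall>\<^sub>F n in sequentially. ?e n \<odot> a < D" .
    from frequently_eventually_frequently[OF freq' this] show False
      using True D by (auto simp: \<phi>_zero dest: frequently_ex)
  next
    case False
    define S where "S u = lim (\<lambda>q. O_comp opr (\<lambda>_. 1) 1 q (\<lambda>i. \<phi> (k ^ i) u))" for u
    \<comment> \<open>Terms are indexed from 1, hence the outer factor \<open>k\<close>; the
      composition up to \<open>Suc n\<close> corresponds to the \<open>n\<close>-th iterate.\<close>
    have S_lim: "(\<lambda>n. \<phi> k (((\<lambda>w. u \<odot> \<phi> k w) ^^ n) u)) \<longlonglongrightarrow> S u" if "a \<le> u" for u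
    proof -
      have "(\<lambda>q. O_comp opr (\<lambda>_. 1) 1 q (\<lambda>i. \<phi> (k ^ i) u)) \<longlonglongrightarrow> S u"
        using assms(4) that by (simp add: phi6_def S_def convergent_LIMSEQ_iff)
      from LIMSEQ_Suc[OF this] show ?thesis
        using pattern_comp_one_\<phi>_power[OF k_nonneg that, of 1] by (simp add: O_comp_def del: upt_Suc)
    qed
    have "(\<lambda>n. \<phi> k (((\<lambda>w. a \<odot> \<phi> k w) ^^ n) a)) = (\<lambda>n. a)"
    proof
      fix n
      have "((\<lambda>w. a \<odot> \<phi> k w) ^^ n) a = a"
        by (induction n) (use k_nonneg in \<open>auto simp: \<phi>_a opr_a_a\<close>)
      then show "\<phi> k (((\<lambda>w. a \<odot> \<phi> k w) ^^ n) a) = a"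
        using k_nonneg by (simp add: \<phi>_a)
    qed
    with S_lim[of a] have "S a = a"
      by (simp add: LIMSEQ_const_iff)
    moreover have "(\<lambda>n. S (?e n)) \<longlonglongrightarrow> S a"
      using assms(4) e_lim e_ge
      by (intro continuous_within_tendsto_compose'[of a "{a..}" S]) (auto simp: phi6_def S_def[abs_def])
    ultimately have "(\<lambda>n. S (?e n)) \<longlonglongrightarrow> a"
      by simp
    \<comment> \<open>A level strictly between \<open>a\<close> and \<open>D\<close>: iterates with
      limit at least \<open>D\<close> eventually exceed \<open>w\<close>, whereas
      \<open>S (?e n)\<close> eventually drops below \<open>\<phi> k w > a\<close>.\<close>
    moreover define w where "w = (a + D) / 2"
    have w: "a < w" "w < D" using D by (auto simp: w_def)
    have "a < \<phi> k w"
      using \<phi>_strict_right[of k a w] \<phi>_a[of k] k_nonneg False w by simp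
    ultimately have "\<forall>\<^sub>F n in sequentially. S (?e n) < \<phi> k w"
      by (rule order_tendstoD(2))
    from frequently_eventually_frequently[OF freq' this]
    obtain n where n: "D \<le> ?e n \<odot> \<phi> k D" "S (?e n) < \<phi> k w"
      by (auto dest: frequently_ex)
    obtain z where z: "\<And>w. a \<le> w \<Longrightarrow> (\<lambda>m. ((\<lambda>w. ?e n \<odot> \<phi> k w) ^^ m) w) \<longlonglongrightarrow> z"
      using \<phi>5 e_ge[of n] unfolding phi5_def by blast
    \<comment> \<open>The iterates here start at \<open>D\<close>, those in \<open>S_lim\<close> at
      \<open>?e n\<close>; by \<open>phi5\<close> both have the limit \<open>z\<close>.\<close>
    have "D \<le> z"
      using n(1) D e_ge[of n] by (intro le_phi5_limit[OF _ _ _ z]) auto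
    then have "\<forall>\<^sub>F m in sequentially. w < ((\<lambda>w. ?e n \<odot> \<phi> k w) ^^ m) (?e n)"
      using w by (intro order_tendstoD(1)[OF z[OF e_ge]]) auto
    then have "\<forall>\<^sub>F m in sequentially. \<phi> k w \<le> \<phi> k (((\<lambda>w. ?e n \<odot> \<phi> k w) ^^ m) (?e n))"
      by (rule eventually_mono) (use k_nonneg w in \<open>auto intro: \<phi>_mono_right\<close>)
    then have "\<phi> k w \<le> S (?e n)"
      by (intro tendsto_lowerbound[OF S_lim[OF e_ge]]) auto
    with n(2) show False by simp
  qed
qed

end

theorem theorem4p2:
  fixes a k :: real
    and opr :: "real \<Rightarrow> real \<Rightarrow> real"
    and X :: "'x set"
    and d :: "'x \<Rightarrow> 'x \<Rightarrow> real"
    and \<phi> :: "real \<Rightarrow> real \<Rightarrow> real"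
    and T :: "'x \<Rightarrow> 'x"
  assumes "o_metric_space a opr X d"
    and "\<And>r u. 0 \<le> r \<Longrightarrow> a \<le> u \<Longrightarrow> a \<le> \<phi> r u"
    and "0 \<le> k" and "k < Sup (C_phi a opr \<phi>)"
    and "phi0 a \<phi>" and "phi1 a \<phi>" and "phi2 a \<phi>" and "phi3 a \<phi>" and "phi4 a opr \<phi>"
    and "phi5 a opr \<phi> k"
    and "T \<in> X \<rightarrow> X"
    and "\<And>x y. x \<in> X \<Longrightarrow> y \<in> X \<Longrightarrow>
      d (T x) (T y) \<le> \<phi> k (Max {d x y, d x (T x), d y (T y), d x (T y), d y (T x)})"
    and "orbitally_complete a X d T"
    and "seq_continuous_fst a X d \<or> seq_continuous_map a X d T \<or> phi6 a opr \<phi> k"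
  shows "\<exists>!x. x \<in> X \<and> T x = x"
proof -
  interpret o_metric_space a opr X d by fact
  interpret dilated_o_metric_space a opr X d \<phi>
    by unfold_locales (use assms in auto)
  interpret quasi_contraction a opr X d \<phi> k T
    by unfold_locales (use assms less_Sup_C_phi_less_one in auto)
  obtain x where x: "x \<in> X" using X_nonempty by blast
  have "range (\<lambda>n. (T ^^ n) x) \<subseteq> orbit_of T x" by (simp add: orbit_of_def)
  with x orbit_Cauchy[OF x] assms(13)
  obtain l where l: "l \<in> X" "o_converges a d (\<lambda>n. (T ^^ n) x) l"
    unfolding orbitally_complete_def by blast
  have "T l = l"
    using assms(14) limit_fixed_seq_continuous_fst[OF x l] limit_fixed_seq_continuous_map[OF x l]
      limit_fixed_phi6[OF x l] by blast
  with l(1) fixed_point_unique show ?thesis by blast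
qed

end
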